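(* Let $\mathbf{B}$ be the countable atomless Boolean algebra. Then there exists a coloring $\chi$ of the 3-atom subalgebras of $\mathbf{B}$ (i.e. the subalgebras of $\mathbf{B}$ isomorphic to the Boolean algebra with exactly $3$ atoms) with infinitely many colors, say $\chi$ taking values in $\omega=\{0,1,2,\dots\}$ with infinite image, such that every countable atomless subalgebra $\mathbf{C}$ of $\mathbf{B}$ contains a 3-atom subalgebra of every color, i.e. for every color $n$ in the image of $\chi$ there is a 3-atom subalgebra $\mathbf{D}\subseteq \mathbf{C}$ with $\chi(\mathbf{D})=n$. *)

theory Defs
  imports Main "HOL-Library.Countable_Set" "HOL-Library.Numeral_Type"
begin

definition subalgebra :: "'a::boolean_algebra set \<Rightarrow> bool" where
  "subalgebra S \<longleftrightarrow>
     bot \<in> S \<and> top \<in> S \<and>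
     (\<forall>x\<in>S. \<forall>y\<in>S. inf x y \<in> S \<and> sup x y \<in> S) \<and>
     (\<forall>x\<in>S. - x \<in> S)"

definition atoms :: "'a::boolean_algebra set \<Rightarrow> 'a set" where
  "atoms S = {a \<in> S. a \<noteq> bot \<and> (\<forall>x\<in>S. x \<le> a \<longrightarrow> x = bot \<or> x = a)}"

text \<open>Nontriviality is part of the notion, since the one-element algebra has no atoms
  either. A countable atomless subalgebra is thus infinite.\<close>

definition countable_atomless :: "'a::boolean_algebra set \<Rightarrow> bool" where
  "countable_atomless S \<longleftrightarrow>
     countable S \<and> (bot :: 'a) \<noteq> top \<and> atoms S = {}"

definition boolean_iso ::
  "('b::boolean_algebra \<Rightarrow> 'a::boolean_algebra) \<Rightarrow> 'b set \<Rightarrow> 'a set \<Rightarrow> bool" where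
  "boolean_iso f S T \<longleftrightarrow>
     bij_betw f S T \<and> f bot = bot \<and> f top = top \<and>
     (\<forall>x\<in>S. \<forall>y\<in>S. f (inf x y) = inf (f x) (f y) \<and> f (sup x y) = sup (f x) (f y)) \<and>
     (\<forall>x\<in>S. f (- x) = - f x)"

text \<open>The type \<^typ>\<open>3 set\<close> is the powerset algebra of a three-element set. Merely asking for
  three atoms would also admit infinite algebras with three atoms.\<close>

definition three_atom_subalgebra :: "'a::boolean_algebra set \<Rightarrow> bool" where
  "three_atom_subalgebra D \<longleftrightarrow>
     subalgebra D \<and> (\<exists>f :: 3 set \<Rightarrow> 'a. boolean_iso f UNIV D)"

lemma card_atoms_3: "card (atoms (UNIV :: 3 set set)) = 3"
proof -
  have "atoms (UNIV :: 3 set set) = (\<lambda>x. {x}) ` UNIV"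
    unfolding atoms_def by (auto simp: subset_singleton_iff)
  then show ?thesis
    by (simp add: card_image)
qed

end

theory Submission
  imports Defs
begin

text \<open>
  Write the algebra as an increasing union of finite subalgebras \<open>B n\<close> and fix an ultrafilter
  \<open>u\<close>. In a partition \<open>{a, b, c}\<close> with \<open>c \<in> u\<close>, ask for each \<open>n\<close> whether some element of \<open>B n\<close>
  is disjoint from \<open>c\<close> but meets \<open>a\<close> (equivalently \<open>b\<close>) outside \<open>B n\<close>. The answer is
  negative for \<open>n = 0\<close> and for large \<open>n\<close>, but need not be monotone, and the color counts how often
  it turns from no to yes.

  Inside an atomless subalgebra \<open>C\<close> the count can be raised by exactly one. Take a nonzero
  \<open>v \<le> c\<close> in \<open>C\<close>, outside \<open>u\<close>, so small that it contains no nonzero element of a level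
  \<open>B N\<close> by which the given partition is resolved, and give a suitable \<open>p \<le> v\<close> to \<open>a\<close> and the rest
  of \<open>v\<close> to \<open>b\<close>. Up to \<open>N\<close> nothing changes. If \<open>m\<close> is the first level with an element below \<open>v\<close> on
  which \<open>C\<close> has infinite trace, then \<open>p\<close> can be chosen disjoint from everything in \<open>B (m - 1)\<close> below
  \<open>v\<close> and unresolved from \<open>m\<close> until \<open>p\<close> itself enters the filtration, so the answer is
  yes on exactly one further interval.
\<close>

section \<open>Subalgebras and atomless algebras\<close>

lemma subalgebra_closed:
  assumes "subalgebra S"
  shows "bot \<in> S" "top \<in> S"
    "x \<in> S \<Longrightarrow> y \<in> S \<Longrightarrow> inf x y \<in> S"
    "x \<in> S \<Longrightarrow> y \<in> S \<Longrightarrow> sup x y \<in> S"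
    "x \<in> S \<Longrightarrow> - x \<in> S"
    "x \<in> S \<Longrightarrow> y \<in> S \<Longrightarrow> x - y \<in> S"
  using assms unfolding subalgebra_def diff_eq by auto

lemma atomless_split:
  assumes "atoms C = {}" "v \<in> C" "v \<noteq> bot"
  obtains w where "w \<in> C" "w \<le> v" "w \<noteq> bot" "w \<noteq> v"
  using assms unfolding atoms_def by auto

lemma atomless_infinite_below:
  assumes "atoms C = {}" "v \<in> C" "v \<noteq> bot"
  shows "infinite {p \<in> C. p \<le> v}"
proof
  assume "finite {p \<in> C. p \<le> v}"
  then have "finite ({p \<in> C. p \<le> v} - {bot})" by simp
  moreover have "{p \<in> C. p \<le> v} - {bot} \<noteq> {}" using assms by auto
  ultimately obtain m where m: "m \<in> {p \<in> C. p \<le> v} - {bot}"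
    and min: "\<forall>b \<in> {p \<in> C. p \<le> v} - {bot}. b \<le> m \<longrightarrow> m = b"
    using finite_has_minimal by meson
  obtain w where "w \<in> C" "w \<le> m" "w \<noteq> bot" "w \<noteq> m"
    using atomless_split[OF assms(1), of m] m by auto
  then show False using m min by (auto dest: order_trans)
qed

text \<open>A nonzero \<open>g\<close> cannot lie below both of the disjoint nonzero pieces
  \<open>w\<close> and \<open>v - w\<close>, so one of the pieces avoids it. Shrinking
  \<open>v\<close> keeps the earlier exclusions.\<close>

lemma atomless_avoid:
  assumes "subalgebra C" "atoms C = {}" "c \<in> C" "c \<noteq> bot" "finite G" "bot \<notin> G"
  obtains v where "v \<in> C" "v \<noteq> bot" "v \<le> c" "\<And>g. g \<in> G \<Longrightarrow> \<not> g \<le> v"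
proof -
  have "\<exists>v\<in>C. v \<noteq> bot \<and> v \<le> c \<and> (\<forall>g\<in>G. \<not> g \<le> v)"
    using assms(5,6)
  proof (induction G rule: finite_induct)
    case empty
    then show ?case using assms by auto
  next
    case (insert g G)
    then obtain v where v: "v \<in> C" "v \<noteq> bot" "v \<le> c" "\<forall>g\<in>G. \<not> g \<le> v" by auto
    obtain w where w: "w \<in> C" "w \<le> v" "w \<noteq> bot" "w \<noteq> v"
      using atomless_split[OF assms(2) v(1,2)] .
    have d: "v - w \<in> C" "v - w \<noteq> bot" "v - w \<le> v"
      using w v(1) subalgebra_closed(6)[OF assms(1)]
      by (auto simp: diff_eq inf_shunt)
    have "\<not> (g \<le> w \<and> g \<le> v - w)"
    proof
      assume "g \<le> w \<and> g \<le> v - w"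
      then have "g \<le> inf w (- w)" unfolding diff_eq le_inf_iff by blast
      then show False using insert.prems by (simp add: bot_unique)
    qed
    then show ?case
      using v w d by (metis insert_iff order_trans)
  qed
  then show ?thesis using that by blast
qed

text \<open>The witness is the join of all elements of \<open>S\<close> below \<open>v\<close>.
  Being disjoint from \<open>g\<close> amounts to being disjoint from all of them.\<close>

lemma finite_subalgebra_greatest_below:
  assumes "subalgebra S" "finite S"
  obtains g where "g \<in> S" "g \<le> v" "\<And>K. K \<in> S \<Longrightarrow> K \<le> v \<Longrightarrow> K \<le> g"
proof -
  have "\<exists>g\<in>S. g \<le> v \<and> (\<forall>K\<in>A. K \<le> g)"
    if "finite A" "A \<subseteq> {K\<in>S. K \<le> v}" for A
    using that
  proof (induction A rule: finite_induct)
    case empty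
    then show ?case using subalgebra_closed(1)[OF assms(1)] by (intro bexI[of _ bot]) auto
  next
    case (insert x A)
    then obtain g where "g \<in> S" "g \<le> v" "\<forall>K\<in>A. K \<le> g" by auto
    then show ?case using insert.prems subalgebra_closed(4)[OF assms(1), of x g]
      by (intro bexI[of _ "sup x g"]) (auto intro: le_supI2)
  qed
  from this[of "{K\<in>S. K \<le> v}"] assms(2) show ?thesis using that by auto
qed

section \<open>The mixing test at one level\<close>

definition mixed :: "'a::boolean_algebra set \<Rightarrow> 'a \<Rightarrow> 'a \<Rightarrow> bool" where
  "mixed S a c \<longleftrightarrow> (\<exists>K\<in>S. inf K c = bot \<and> inf K a \<notin> S)"

text \<open>If \<open>K\<close> misses \<open>c\<close>, it is the disjoint union of its traces on
  \<open>a\<close> and \<open>b\<close>, so either trace yields the other as a difference from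
  \<open>K\<close>. The test therefore does not depend on which of the two parts is named.\<close>

lemma mixed_other_part:
  assumes "subalgebra S" "inf a b = bot" "sup (sup a b) c = top" "mixed S a c"
  shows "mixed S b c"
proof -
  obtain K where K: "K \<in> S" "inf K c = bot" "inf K a \<notin> S"
    using assms(4) unfolding mixed_def by blast
  have "K = inf K (sup (sup a b) c)" using assms(3) by simp
  then have *: "K = sup (inf K a) (inf K b)" by (simp add: inf_sup_distrib1 K(2))
  have "K - inf K b = inf K (- b)" by (simp add: diff_eq inf_sup_distrib1)
  also have "\<dots> = inf (sup (inf K a) (inf K b)) (- b)" using * by simp
  also have "\<dots> = inf K (inf a (- b))"
    by (simp add: inf_sup_distrib2 inf_assoc)
  also have "inf a (- b) = a" using assms(2) by (simp add: inf_shunt inf_absorb1)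
  finally have "inf K a = K - inf K b" by simp
  then have "inf K b \<notin> S"
    using K subalgebra_closed(6)[OF assms(1)] by metis
  then show ?thesis using K unfolding mixed_def by blast
qed

section \<open>The filtration: \<open>level e n\<close> is generated by the first \<open>n\<close>
  values of \<open>e\<close>\<close>

fun level :: "(nat \<Rightarrow> 'a::boolean_algebra) \<Rightarrow> nat \<Rightarrow> 'a set" where
  "level e 0 = {bot, top}"
| "level e (Suc n) = (\<lambda>(x, y). sup (inf x (e n)) (inf y (- e n))) ` (level e n \<times> level e n)"

lemma finite_level: "finite (level e n)"
  by (induction n) auto

lemma join_inf:
  fixes x y z w e :: "'a::boolean_algebra"
  shows "inf (sup (inf x e) (inf y (- e))) (sup (inf z e) (inf w (- e)))
    = sup (inf (inf x z) e) (inf (inf y w) (- e))"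
  by (simp add: inf_sup_distrib1 inf_sup_distrib2 inf_assoc inf_left_commute inf_commute)

lemma join_sup:
  fixes x y z w e :: "'a::boolean_algebra"
  shows "sup (sup (inf x e) (inf y (- e))) (sup (inf z e) (inf w (- e)))
    = sup (inf (sup x z) e) (inf (sup y w) (- e))"
  by (simp add: inf_sup_distrib2 sup_assoc sup_left_commute)

lemma join_same:
  fixes x e :: "'a::boolean_algebra"
  shows "sup (inf x e) (inf x (- e)) = x"
  by (simp flip: inf_sup_distrib1)

lemma join_uminus:
  fixes x y e :: "'a::boolean_algebra"
  shows "- sup (inf x e) (inf y (- e)) = sup (inf (- x) e) (inf (- y) (- e))"
  by (rule compl_unique) (simp_all add: join_inf join_sup join_same)

lemma subalgebra_level: "subalgebra (level e n)"
proof (induction n)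
  case 0
  then show ?case by (auto simp: subalgebra_def)
next
  case (Suc n)
  note cl = subalgebra_closed[OF Suc]
  let ?j = "\<lambda>(x, y). sup (inf x (e n)) (inf y (- e n))"
  have mem: "?j (x, y) \<in> level e (Suc n)" if "x \<in> level e n" "y \<in> level e n" for x y
    using that by auto
  show ?case
    unfolding subalgebra_def
  proof (intro conjI ballI)
    show "bot \<in> level e (Suc n)" using mem[of bot bot] cl(1) by simp
    show "top \<in> level e (Suc n)" using mem[of top top] cl(2) by simp
  next
    fix s t assume "s \<in> level e (Suc n)" "t \<in> level e (Suc n)"
    then obtain x y z w where "s = ?j (x, y)" "t = ?j (z, w)"
      "x \<in> level e n" "y \<in> level e n" "z \<in> level e n" "w \<in> level e n" by auto
    then show "inf s t \<in> level e (Suc n)" "sup s t \<in> level e (Suc n)"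
      using mem[of "inf x z" "inf y w"] mem[of "sup x z" "sup y w"] cl(3,4)
      by (auto simp only: join_inf join_sup prod.case)
  next
    fix s assume "s \<in> level e (Suc n)"
    then obtain x y where "s = ?j (x, y)" "x \<in> level e n" "y \<in> level e n" by auto
    then show "- s \<in> level e (Suc n)"
      using mem[of "- x" "- y"] cl(5) by (auto simp only: join_uminus prod.case)
  qed
qed

lemma level_Suc_subset: "level e n \<subseteq> level e (Suc n)"
proof
  fix x assume "x \<in> level e n"
  then show "x \<in> level e (Suc n)"
    using join_same[of x "e n"] by (auto intro!: image_eqI[of _ _ "(x, x)"])
qed

lemma level_contains: "e n \<in> level e (Suc n)"
  using subalgebra_closed(1,2)[OF subalgebra_level, of e n]
  by (auto intro!: image_eqI[of _ _ "(top, bot)"])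

section \<open>An ultrafilter from a descending branch\<close>

fun branch :: "(nat \<Rightarrow> 'a::boolean_algebra) \<Rightarrow> nat \<Rightarrow> 'a" where
  "branch e 0 = top"
| "branch e (Suc n) =
    (if inf (branch e n) (e n) \<noteq> bot then inf (branch e n) (e n) else inf (branch e n) (- e n))"

lemma branch_nonzero:
  assumes "(bot :: 'a::boolean_algebra) \<noteq> top"
  shows "branch (e :: nat \<Rightarrow> 'a) n \<noteq> bot"
proof (induction n)
  case (Suc n)
  then show ?case using join_same[of "branch e n" "e n"] by auto
qed (use assms in auto)

lemma decseq_branch: "m \<le> n \<Longrightarrow> branch e n \<le> branch e m"
  by (rule lift_Suc_antimono_le[of "branch e"]) auto

text \<open>Upward closure follows from the three clauses: if \<open>x \<in> u\<close>,
  \<open>x \<le> y\<close> and \<open>y \<notin> u\<close>, then \<open>- y \<in> u\<close>, and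
  \<open>inf x (- y) = bot\<close> would be in \<open>u\<close>.\<close>

definition ultrafilter :: "'a::boolean_algebra set \<Rightarrow> bool" where
  "ultrafilter u \<longleftrightarrow> bot \<notin> u \<and> (\<forall>x\<in>u. \<forall>y\<in>u. inf x y \<in> u) \<and> (\<forall>x. x \<in> u \<or> - x \<in> u)"

text \<open>The branch decides \<open>e n\<close> at stage \<open>Suc n\<close>, and
  \<open>e\<close> enumerates the algebra, so the upward closure of the branch decides every
  element.\<close>

lemma countable_ultrafilter_exists:
  assumes "(bot :: 'a::boolean_algebra) \<noteq> top" and e: "range (e :: nat \<Rightarrow> 'a) = UNIV"
  shows "\<exists>u :: 'a set. ultrafilter u"
proof -
  let ?u = "{x. \<exists>n. branch e n \<le> x}"
  have "ultrafilter ?u"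
    unfolding ultrafilter_def
  proof (intro conjI ballI allI impI)
    fix x y assume "x \<in> ?u" "y \<in> ?u"
    then obtain m n where "branch e m \<le> x" "branch e n \<le> y" by auto
    then have "branch e (max m n) \<le> inf x y"
      using decseq_branch[of m "max m n" e] decseq_branch[of n "max m n" e]
      by (auto intro: order_trans)
    then show "inf x y \<in> ?u" by blast
  next
    fix x
    obtain n where "x = e n" using e by (metis rangeE UNIV_I)
    moreover have "branch e (Suc n) \<le> e n \<or> branch e (Suc n) \<le> - e n" by simp
    ultimately show "x \<in> ?u \<or> - x \<in> ?u" by blast
  qed (simp add: bot_unique branch_nonzero[OF assms(1)])
  then show ?thesis by blast
qed


section \<open>Traces, oscillation, and raising the count by one\<close>

lemma trace_separation:
  assumes C: "subalgebra C" and Q: "Q = {p \<in> C. p \<le> v}"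
    and fin: "finite (inf g ` Q)" and inf: "infinite (inf K ` Q)" and F: "finite F"
  obtains p where "p \<in> Q" "inf g p = bot" "inf K p \<notin> F"
proof -
  \<comment> \<open>Pigeonhole over the finitely many traces on \<open>g\<close>: one fiber still
    has infinitely many traces on \<open>K\<close>.\<close>
  have "inf K ` Q = (\<Union>t\<in>inf g ` Q. inf K ` {p \<in> Q. inf g p = t})" by auto
  with fin inf obtain t where t: "infinite (inf K ` {p \<in> Q. inf g p = t})"
    by (metis (no_types, lifting) finite_UN_I)
  txt \<open>Differences of elements with the same trace on \<open>g\<close> have trace \<open>bot\<close> there.\<close>
  then obtain p0 where p0: "p0 \<in> Q" "inf g p0 = t"
    by (metis (mono_tags, lifting) empty_Collect_eq finite.emptyI image_empty)
  \<comment> \<open>\<open>?h\<close> rebuilds \<open>inf K p\<close> from the traces on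
    \<open>K\<close> of \<open>p - p0\<close> and \<open>p0 - p\<close>. It takes finitely many
    values on pairs from \<open>F\<close>; for \<open>p\<close> avoiding them, one of the two
    differences has its trace outside \<open>F\<close>.\<close>
  let ?h = "\<lambda>(x, y). sup x (inf K p0 - y)"
  have "\<not> inf K ` {p \<in> Q. inf g p = t} \<subseteq> ?h ` (F \<times> F)"
    using t F finite_subset by blast
  then obtain p where p: "p \<in> Q" "inf g p = t" "inf K p \<notin> ?h ` (F \<times> F)" by auto
  have "inf K p0 - inf K (p0 - p) = inf (inf K p) p0"
    by (simp add: diff_eq inf_sup_distrib1 inf_assoc inf_left_commute inf_commute)
  then have "inf K p = ?h (inf K (p - p0), inf K (p0 - p))"
    using join_same[of "inf K p" p0] by (simp add: diff_eq inf_assoc sup_commute)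
  then have "inf K (p - p0) \<notin> F \<or> inf K (p0 - p) \<notin> F" using p(3) by blast
  moreover have "x - y \<in> Q" "inf g (x - y) = bot"
    if "x \<in> Q" "y \<in> Q" "inf g x = t" "inf g y = t" for x y
  proof -
    show "x - y \<in> Q" using that subalgebra_closed(6)[OF C] unfolding Q
      by (auto simp: diff_eq intro: le_infI1)
    have "inf g (x - y) = inf (inf g x) (- y)" by (simp add: diff_eq inf_assoc)
    also have "inf g x = inf g y" using that by simp
    finally show "inf g (x - y) = bot" by (simp add: inf_assoc)
  qed
  ultimately show ?thesis using that p p0 by metis
qed

text \<open>For a filtration the set is finite, because \<open>a\<close> lies in \<open>B n\<close>
  for all large \<open>n\<close>; so \<open>card\<close> is a true count and not the default
  \<open>0\<close> of infinite sets.\<close>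

definition oscillation :: "(nat \<Rightarrow> 'a::boolean_algebra set) \<Rightarrow> 'a \<Rightarrow> 'a \<Rightarrow> nat" where
  "oscillation B a c = card {n. \<not> mixed (B n) a c \<and> mixed (B (Suc n)) a c}"

locale filtration =
  fixes B :: "nat \<Rightarrow> 'a::boolean_algebra set" and u :: "'a set"
  assumes subalg: "subalgebra (B n)"
    and fin: "finite (B n)"
    and mono: "m \<le> n \<Longrightarrow> B m \<subseteq> B n"
    and exhaust: "\<exists>n. x \<in> B n"
    and uf: "ultrafilter u"
begin

lemma not_mixed: "a \<in> B n \<Longrightarrow> \<not> mixed (B n) a c"
  unfolding mixed_def using subalgebra_closed(3)[OF subalg] by blast

text \<open>If \<open>K\<close> misses \<open>c - v\<close>, then \<open>inf K c\<close> is an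
  element of \<open>B N\<close> below \<open>v\<close>, hence \<open>bot\<close>. So the same
  \<open>K\<close> are tested before and after, and as they miss \<open>p\<close>, their traces do
  not change.\<close>

lemma mixed_extend_low:
  assumes cN: "c \<in> B N" and "n \<le> N"
    and small: "\<And>g. g \<in> B N \<Longrightarrow> g \<le> v \<Longrightarrow> g = bot" and pv: "p \<le> v" "v \<le> c"
  shows "mixed (B n) (sup a p) (c - v) \<longleftrightarrow> mixed (B n) a c"
proof -
  have *: "inf K (c - v) = bot \<longleftrightarrow> inf K c = bot" if "K \<in> B n" for K
  proof
    assume "inf K (c - v) = bot"
    then have "inf (inf K c) (- v) = bot" by (simp add: diff_eq inf_assoc)
    then have "inf K c \<le> v" by (simp add: inf_shunt)
    moreover have "inf K c \<in> B N"
      using that cN mono[OF \<open>n \<le> N\<close>] subalgebra_closed(3)[OF subalg] by blast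
    ultimately show "inf K c = bot" using small by blast
  next
    assume "inf K c = bot"
    then show "inf K (c - v) = bot" by (simp add: diff_eq flip: inf_assoc)
  qed
  have "inf K (sup a p) = inf K a" if "inf K c = bot" for K
  proof -
    have "inf K p \<le> inf K c" using pv by (auto intro: le_infI2)
    then show ?thesis using that by (simp add: inf_sup_distrib1 bot_unique)
  qed
  with * show ?thesis unfolding mixed_def by metis
qed

text \<open>Once \<open>a\<close> and \<open>c\<close> are in \<open>B n\<close>, a witness
  \<open>K\<close> can be cut down to \<open>inf K c\<close>, which lies below \<open>v\<close>, and
  its trace on \<open>a\<close> is already in \<open>B n\<close>. Only the trace on \<open>p\<close>
  is left to test.\<close>

lemma mixed_extend_high:
  assumes ac: "inf a c = bot" and aN: "a \<in> B n" and cN: "c \<in> B n" and pv: "p \<le> v" "v \<le> c"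
  shows "mixed (B n) (sup a p) (c - v) \<longleftrightarrow> (\<exists>K\<in>B n. K \<le> v \<and> inf K p \<notin> B n)"
proof
  note cl = subalgebra_closed[OF subalg]
  assume "mixed (B n) (sup a p) (c - v)"
  then obtain K where K: "K \<in> B n" "inf K (c - v) = bot" "inf K (sup a p) \<notin> B n"
    unfolding mixed_def by blast
  have "inf K c \<le> v" using K(2) by (simp add: diff_eq inf_shunt flip: inf_assoc)
  moreover have "inf K c \<in> B n" using K cN cl by blast
  moreover have "inf (inf K c) p = inf K p"
    using pv by (metis inf.absorb2 inf_assoc order_trans)
  moreover have "inf K p \<notin> B n" using K aN cl by (metis inf_sup_distrib1)
  ultimately show "\<exists>K\<in>B n. K \<le> v \<and> inf K p \<notin> B n" by metis
next
  assume "\<exists>K\<in>B n. K \<le> v \<and> inf K p \<notin> B n"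
  then obtain K where K: "K \<in> B n" "K \<le> v" "inf K p \<notin> B n" by blast
  have "inf K (c - v) \<le> inf v (- v)" using K(2) unfolding diff_eq
    by (blast intro: inf_mono inf_le2)
  moreover have "inf K a \<le> inf a c" using K(2) pv by (auto intro: le_infI1)
  ultimately show "mixed (B n) (sup a p) (c - v)"
    unfolding mixed_def using K ac by (intro bexI[of _ K]) (auto simp: inf_sup_distrib1 bot_unique)
qed

lemma oscillation_extend:
  assumes C: "subalgebra C" "atoms C = {}"
    and ac: "a \<in> C" "c \<in> C" "inf a c = bot" "c \<in> u"
  obtains a' c' where "a' \<in> C" "c' \<in> C" "inf a' c' = bot" "c' \<in> u"
    "oscillation B a' c' = Suc (oscillation B a c)"
proof -
  note cl = subalgebra_closed[OF subalg]
  obtain Na Nc where "a \<in> B Na" "c \<in> B Nc" using exhaust by metis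
  then obtain N where N: "a \<in> B N" "c \<in> B N"
    using mono[of Na "max Na Nc"] mono[of Nc "max Na Nc"] by auto
  have "c \<noteq> bot" using uf ac(4) unfolding ultrafilter_def by auto
  then obtain v0 where v0: "v0 \<in> C" "v0 \<noteq> bot" "v0 \<le> c"
    and small0: "\<And>g. g \<in> B N - {bot} \<Longrightarrow> \<not> g \<le> v0"
    using atomless_avoid[OF C ac(2), of "B N - {bot}"] fin[of N] by auto
  \<comment> \<open>Two disjoint pieces cannot both be in \<open>u\<close>. Taking for
    \<open>v\<close> a piece outside \<open>u\<close> keeps \<open>c - v\<close> in
    \<open>u\<close>.\<close>
  obtain w where w: "w \<in> C" "w \<le> v0" "w \<noteq> bot" "w \<noteq> v0"
    using atomless_split[OF C(2) v0(1,2)] .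
  have "v0 - w \<in> C" "v0 - w \<noteq> bot" "v0 - w \<le> v0"
    using w v0(1) subalgebra_closed(6)[OF C(1)] by (auto simp: diff_eq inf_shunt)
  moreover have "inf w (v0 - w) = bot"
    by (simp add: diff_eq inf_left_commute)
  then have "w \<notin> u \<or> v0 - w \<notin> u" using uf unfolding ultrafilter_def by metis
  ultimately obtain v where v: "v \<in> C" "v \<noteq> bot" "v \<le> v0" "v \<notin> u" using w by metis
  have vc: "v \<le> c" using v v0 by auto
  have small: "g = bot" if "g \<in> B N" "g \<le> v" for g
    using small0[of g] that order_trans[OF _ v(3), of g] by auto
  define Q where "Q = {p \<in> C. p \<le> v}"
  have infQ: "infinite Q" unfolding Q_def by (rule atomless_infinite_below[OF C(2) v(1,2)])
  have imQ: "inf v ` Q = Q" unfolding Q_def by (force simp: inf_absorb2 image_iff)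
  obtain M where M: "v \<in> B M" using exhaust by blast
  define rich where "rich n \<longleftrightarrow> (\<exists>K\<in>B n. K \<le> v \<and> infinite (inf K ` Q))" for n
  have richM: "rich M" unfolding rich_def using M imQ infQ by (intro bexI[of _ v]) auto
  define m where "m = (LEAST n. rich n)"
  have m: "rich m" "m \<le> M" "\<And>n. n < m \<Longrightarrow> \<not> rich n"
    unfolding m_def using richM by (auto intro: LeastI Least_le dest: not_less_Least)
  obtain K0 where K0: "K0 \<in> B m" "K0 \<le> v" "infinite (inf K0 ` Q)"
    using m(1) unfolding rich_def by blast
  \<comment> \<open>This gives \<open>N < m\<close>, so \<open>m - 1\<close> is a true predecessor,
    and level \<open>m - 1\<close> will separate the old yes-levels, all below \<open>N\<close>,
    from the new ones.\<close>
  have "\<not> rich n" if "n \<le> N" for n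
  proof
    assume "rich n"
    then obtain K where K: "K \<in> B n" "K \<le> v" "infinite (inf K ` Q)" unfolding rich_def by blast
    then have "K = bot" using small mono[OF that] by blast
    then have "inf K ` Q \<subseteq> {bot}" by auto
    with K(3) show False using finite_subset by blast
  qed
  then have Nm: "N < m" using m(1) not_less by blast
  obtain g where g: "g \<in> B (m - 1)" "g \<le> v" "\<And>K. K \<in> B (m - 1) \<Longrightarrow> K \<le> v \<Longrightarrow> K \<le> g"
    using finite_subalgebra_greatest_below[OF subalg fin] by metis
  have "finite (inf g ` Q)" using m(3)[of "m - 1"] g Nm unfolding rich_def by auto
  \<comment> \<open>Avoiding \<open>B M\<close>, and not just \<open>B m\<close>, keeps
    \<open>K0\<close> a witness at every level from \<open>m\<close> to \<open>M\<close>. It also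
    forces \<open>p\<close> out of \<open>B M\<close>, so that \<open>v\<close> can take over as
    witness from \<open>M\<close> on.\<close>
  then obtain p where p: "p \<in> Q" "inf g p = bot" "inf K0 p \<notin> B M"
    using trace_separation[OF C(1) Q_def _ K0(3) fin] by metis
  have pC: "p \<in> C" and pv: "p \<le> v" using p(1) unfolding Q_def by auto
  define L where "L = (LEAST n. p \<in> B n)"
  have pL: "p \<in> B L" unfolding L_def using exhaust by (rule LeastI_ex)
  have ltL: "p \<notin> B n" if "n < L" for n using that not_less_Least unfolding L_def by blast
  have pM: "p \<notin> B M" using p(3) K0(1) mono[OF m(2)] cl by blast
  then have M_less_L: "M < L" using mono[of L M] pL by (meson not_less subsetD)
  define W where "W = {n. mixed (B n) a c}"
  define W' where "W' = {n. mixed (B n) (sup a p) (c - v)}"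
  have WN: "n < N" if "n \<in> W" for n
    using that not_mixed mono[of N n] N(1) unfolding W_def by (meson mem_Collect_eq not_le subsetD)
  have high: "n \<in> W' \<longleftrightarrow> m \<le> n \<and> n < L" if "N \<le> n" for n
  proof -
    have "a \<in> B n" "c \<in> B n" using N mono[OF that] by auto
    note eq = mixed_extend_high[OF ac(3) this pv vc]
    \<comment> \<open>In turn: \<open>p\<close> misses everything below \<open>g\<close>;
      \<open>K0\<close> is the witness; \<open>v\<close> is the witness, with trace
      \<open>p\<close>; \<open>p\<close> is resolved.\<close>
    consider "n < m" | "m \<le> n" "n < M" | "M \<le> n" "n < L" | "L \<le> n" by linarith
    then show ?thesis
    proof cases
      case 1
      have "inf K p = bot" if "K \<in> B n" "K \<le> v" for K
      proof -
        have "n \<le> m - 1" using 1 by simp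
        then have "K \<le> g" using g(3) that mono by blast
        then have "inf K p \<le> inf g p" by (rule inf_mono) simp
        then show ?thesis using p(2) by (simp add: bot_unique)
      qed
      then show ?thesis using eq 1 cl(1) unfolding W'_def by auto
    next
      case 2
      then have "K0 \<in> B n" "inf K0 p \<notin> B n"
        using K0 p(3) mono[of m n] mono[of n M] by auto
      then show ?thesis using eq 2 K0(2) M_less_L unfolding W'_def by auto
    next
      case 3
      have "v \<in> B n" "inf v p \<notin> B n"
        using M mono[OF 3(1)] ltL[OF 3(2)] pv by (auto simp: inf_absorb2)
      then show ?thesis using eq 3 m(2) unfolding W'_def by auto
    next
      case 4
      then have "p \<in> B n" using pL mono by blast
      then show ?thesis using eq 4 cl unfolding W'_def by auto
    qed
  qed
  have low: "n \<in> W' \<longleftrightarrow> n \<in> W" if "n \<le> N" for n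
    unfolding W_def W'_def mem_Collect_eq
    by (rule mixed_extend_low[OF N(2) that small pv vc])
  have W': "n \<in> W' \<longleftrightarrow> n \<in> W \<or> m \<le> n \<and> n < L" for n
    using low[of n] high[of n] WN[of n] Nm by (cases "n \<le> N") auto
  define U where "U = {n. n \<notin> W \<and> Suc n \<in> W}"
  \<comment> \<open>The new yes-levels are those of \<open>W\<close> together with the interval from
    \<open>m\<close> to \<open>L - 1\<close>. As \<open>m - 1\<close> is in neither, the old turns
    survive and exactly one is added.\<close>
  have "{n. n \<notin> W' \<and> Suc n \<in> W'} = insert (m - 1) U"
  proof (rule set_eqI)
    fix n
    show "n \<in> {n. n \<notin> W' \<and> Suc n \<in> W'} \<longleftrightarrow> n \<in> insert (m - 1) U"
      using WN[of n] WN[of "Suc n"] Nm m(2) M_less_L unfolding U_def by (auto simp: W')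
  qed
  moreover have "m - 1 \<notin> U" using WN[of m] Nm unfolding U_def by auto
  moreover have "finite U"
    by (rule finite_subset[of _ "{..<N}"]) (use WN in \<open>auto simp: U_def dest: Suc_lessD\<close>)
  ultimately have "oscillation B (sup a p) (c - v) = Suc (oscillation B a c)"
    unfolding oscillation_def U_def W_def W'_def by simp
  moreover have "sup a p \<in> C" "c - v \<in> C" using ac pC v(1) subalgebra_closed[OF C(1)] by auto
  moreover have "inf (sup a p) (c - v) = bot"
  proof -
    have "inf a (c - v) = bot" using ac(3) by (simp add: diff_eq flip: inf_assoc)
    moreover have "inf p (c - v) \<le> inf v (- v)" using pv unfolding diff_eq
      by (blast intro: inf_mono inf_le2)
    ultimately show ?thesis by (simp add: inf_sup_distrib2 bot_unique)
  qed
  moreover have "c - v \<in> u"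
    using uf v(4) ac(4) unfolding ultrafilter_def diff_eq by blast
  ultimately show ?thesis using that by blast
qed


lemma oscillation_attained:
  assumes C: "subalgebra C" "atoms C = {}"
  shows "\<exists>a\<in>C. \<exists>c\<in>C. inf a c = bot \<and> c \<in> u \<and> oscillation B a c = k"
proof (induction k)
  case 0
  have "\<not> mixed (B n) bot top" for n
    using not_mixed subalgebra_closed(1)[OF subalg] by blast
  then have "oscillation B bot top = 0" unfolding oscillation_def by simp
  moreover have "top \<in> u" using uf unfolding ultrafilter_def by (metis compl_top_eq)
  ultimately show ?case using subalgebra_closed[OF C(1)] by (intro bexI[of _ bot] bexI[of _ top]) auto
next
  case (Suc k)
  then obtain a c where "a \<in> C" "c \<in> C" "inf a c = bot" "c \<in> u" "oscillation B a c = k" by blast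
  then show ?case using oscillation_extend[OF C] by metis
qed

end

section \<open>Three-part partitions and the subalgebras they generate\<close>

definition partition_join :: "'a::boolean_algebra \<Rightarrow> 'a \<Rightarrow> 'a \<Rightarrow> 3 set \<Rightarrow> 'a" where
  "partition_join a b c X =
     sup (sup (if 0 \<in> X then a else bot) (if 1 \<in> X then b else bot)) (if 2 \<in> X then c else bot)"

text \<open>Each conditional summand respects meets and joins of index sets, so
  \<open>partition_join\<close> can be computed part by part; \<open>part_disjoint\<close> removes
  the cross terms.\<close>

lemma part_inf: "(if i \<in> X \<inter> Y then a else bot) =
    inf (if i \<in> X then a else bot) (if i \<in> Y then a else (bot :: 'a::boolean_algebra))"
  and part_sup: "(if i \<in> X \<union> Y then a else bot) =
    sup (if i \<in> X then a else bot) (if i \<in> Y then a else (bot :: 'a::boolean_algebra))"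
  by auto

lemma part_disjoint:
  assumes "inf a b = (bot :: 'a::boolean_algebra)"
  shows "inf (if i \<in> X then a else bot) (if j \<in> Y then b else bot) = bot"
    "inf (if j \<in> Y then b else bot) (if i \<in> X then a else bot) = bot"
  using assms by (auto simp: inf_commute)

lemma num3_cases:
  fixes i :: 3
  obtains "i = 0" | "i = 1" | "i = 2"
proof (cases i)
  case (of_int z)
  then have "z = 0 \<or> z = 1 \<or> z = 2" by auto
  then show ?thesis using of_int that by auto
qed

locale three_partition =
  fixes a b c :: "'a::boolean_algebra"
  assumes disjoint: "inf a b = bot" "inf a c = bot" "inf b c = bot"
    and cover: "sup (sup a b) c = top"
    and nonzero: "a \<noteq> bot" "b \<noteq> bot" "c \<noteq> bot"
begin

lemma partition_join_inf:
  "partition_join a b c (X \<inter> Y) = inf (partition_join a b c X) (partition_join a b c Y)"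
  unfolding partition_join_def
  by (simp only: part_inf part_disjoint[OF disjoint(1)] part_disjoint[OF disjoint(2)]
      part_disjoint[OF disjoint(3)] inf_sup_distrib1 inf_sup_distrib2 sup_bot_left sup_bot_right)

lemma partition_join_sup:
  "partition_join a b c (X \<union> Y) = sup (partition_join a b c X) (partition_join a b c Y)"
  unfolding partition_join_def by (simp only: part_sup sup_assoc sup_left_commute)

lemma partition_join_bot: "partition_join a b c {} = bot"
  and partition_join_top: "partition_join a b c UNIV = top"
  using cover unfolding partition_join_def by auto

lemma partition_join_singleton:
  "partition_join a b c {0} = a" "partition_join a b c {1} = b" "partition_join a b c {2} = c"
  unfolding partition_join_def by auto

lemma partition_join_uminus: "partition_join a b c (- X) = - partition_join a b c X"
  by (rule sym, rule compl_unique)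
    (simp_all add: partition_join_bot partition_join_top
      flip: partition_join_inf partition_join_sup)

text \<open>An index in \<open>X\<close> but not in \<open>Y\<close> would give a nonzero part lying
  below, yet disjoint from, the join over \<open>Y\<close>. Injectivity and the description of the
  atoms both rest on this order embedding.\<close>

lemma partition_join_le_iff:
  "partition_join a b c X \<le> partition_join a b c Y \<longleftrightarrow> X \<subseteq> Y"
proof
  assume le: "partition_join a b c X \<le> partition_join a b c Y"
  show "X \<subseteq> Y"
  proof
    fix i assume "i \<in> X"
    show "i \<in> Y"
    proof (rule ccontr)
      assume "i \<notin> Y"
      have "partition_join a b c {i} = partition_join a b c ({i} \<inter> X)" using \<open>i \<in> X\<close> by simp
      also have "\<dots> \<le> inf (partition_join a b c {i}) (partition_join a b c Y)"
        using le by (auto simp: partition_join_inf intro: le_infI2)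
      also have "\<dots> = partition_join a b c ({i} \<inter> Y)" by (simp only: partition_join_inf)
      also have "\<dots> = bot" using \<open>i \<notin> Y\<close> by (simp add: partition_join_bot)
      finally show False
        using nonzero partition_join_singleton by (cases i rule: num3_cases) (auto simp: bot_unique)
    qed
  qed
next
  assume "X \<subseteq> Y"
  then have "Y = X \<union> Y" by auto
  then show "partition_join a b c X \<le> partition_join a b c Y"
    by (metis partition_join_sup sup_ge1)
qed

lemma three_atom_partition: "three_atom_subalgebra (range (partition_join a b c))"
proof -
  have "inj (partition_join a b c)"
    by (rule injI) (metis partition_join_le_iff order_antisym order_refl)
  then have "boolean_iso (partition_join a b c) UNIV (range (partition_join a b c))"
    unfolding boolean_iso_def bij_betw_def
    by (simp add: partition_join_bot partition_join_top partition_join_inf partition_join_sup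
        partition_join_uminus)
  moreover have "subalgebra (range (partition_join a b c))"
    unfolding subalgebra_def
    by (auto simp flip: partition_join_bot partition_join_top partition_join_inf
        partition_join_sup partition_join_uminus)
  ultimately show ?thesis unfolding three_atom_subalgebra_def by blast
qed

text \<open>This recovers the partition from the bare set that the coloring receives.\<close>

lemma atoms_partition: "atoms (range (partition_join a b c)) = {a, b, c}"
proof -
  have eq: "partition_join a b c X = partition_join a b c Y \<longleftrightarrow> X = Y" for X Y
    by (metis partition_join_le_iff order_antisym order_refl)
  have "partition_join a b c X \<in> atoms (range (partition_join a b c)) \<longleftrightarrow> X \<in> atoms UNIV" for X
    unfolding atoms_def by (simp add: partition_join_le_iff eq flip: partition_join_bot)
  moreover have "atoms (range (partition_join a b c)) \<subseteq> range (partition_join a b c)"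
    unfolding atoms_def by blast
  ultimately have "atoms (range (partition_join a b c)) = partition_join a b c ` atoms UNIV"
    by blast
  also have "atoms (UNIV :: 3 set set) = range (\<lambda>i. {i})"
    unfolding atoms_def by (auto simp: subset_singleton_iff)
  also have "range (\<lambda>i :: 3. {i}) = {{0}, {1}, {2}}"
    by (auto simp: image_iff) (metis num3_cases)
  finally show ?thesis by (simp add: partition_join_singleton)
qed

lemma partition_subset:
  assumes "subalgebra C" "a \<in> C" "b \<in> C" "c \<in> C"
  shows "range (partition_join a b c) \<subseteq> C"
  using assms subalgebra_closed[OF assms(1)] unfolding partition_join_def by auto

end

section \<open>The coloring\<close>

context filtration
begin

text \<open>Distinct atoms are disjoint, so at most one is in \<open>u\<close> and \<open>c\<close>
  is determined. For \<open>a\<close> either remaining atom may be picked; by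
  \<open>mixed_other_part\<close> the choice is harmless.\<close>

definition designated :: "'a set \<Rightarrow> 'a \<times> 'a" where
  "designated D = (SOME (a, c). a \<in> atoms D \<and> c \<in> atoms D \<and> a \<noteq> c \<and> c \<in> u)"

text \<open>The shift by one merges oscillations \<open>0\<close> and \<open>1\<close>: oscillation \<open>0\<close> is attained below only by
  the degenerate pair \<open>(bot, top)\<close>, whereas a positive one forces all three parts to be nonzero.\<close>

definition color :: "'a set \<Rightarrow> nat" where
  "color D = (case designated D of (a, c) \<Rightarrow> oscillation B a c - 1)"

lemma color_partition:
  assumes "three_partition a b c" "c \<in> u"
  shows "color (range (partition_join a b c)) = oscillation B a c - 1"
proof -
  interpret three_partition a b c by fact
  have notu: "a \<notin> u" "b \<notin> u"
    using assms(2) disjoint uf unfolding ultrafilter_def by metis+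
  have "a \<noteq> c" using notu assms(2) by auto
  then obtain a' c' where d: "designated (range (partition_join a b c)) = (a', c')"
    "a' \<in> {a, b, c}" "c' \<in> {a, b, c}" "a' \<noteq> c'" "c' \<in> u"
    using someI[of "\<lambda>(x, z). x \<in> {a, b, c} \<and> z \<in> {a, b, c} \<and> x \<noteq> z \<and> z \<in> u" "(a, c)"] assms(2)
    unfolding designated_def atoms_partition by (auto split: prod.splits)
  then have "c' = c" "a' = a \<or> a' = b" using notu by auto
  moreover have "mixed (B n) b c \<longleftrightarrow> mixed (B n) a c" for n
    using mixed_other_part[OF subalg, of a b c] mixed_other_part[OF subalg, of b a c]
      disjoint cover by (auto simp: inf_commute sup_commute)
  then have "oscillation B b c = oscillation B a c" unfolding oscillation_def by simp
  ultimately show ?thesis using d unfolding color_def by auto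
qed

lemma color_attained:
  assumes C: "subalgebra C" "atoms C = {}"
  shows "\<exists>D. three_atom_subalgebra D \<and> D \<subseteq> C \<and> color D = k"
proof -
  obtain a c where ac: "a \<in> C" "c \<in> C" "inf a c = bot" "c \<in> u" "oscillation B a c = Suc k"
    using oscillation_attained[OF C] by blast
  define b where "b = - sup a c"
  \<comment> \<open>A positive count supplies a mixing witness \<open>K\<close>, which excludes
    degenerate parts: the trace of \<open>K\<close> on \<open>a\<close> would be \<open>bot\<close>
    if \<open>a = bot\<close>, and \<open>K\<close> itself if \<open>b = bot\<close>, both in
    \<open>B n\<close>.\<close>
  have "{n. \<not> mixed (B n) a c \<and> mixed (B (Suc n)) a c} \<noteq> {}"
    using ac(5) unfolding oscillation_def by (metis card.empty nat.distinct(1))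
  then obtain n K where K: "K \<in> B n" "inf K c = bot" "inf K a \<notin> B n"
    unfolding mixed_def by auto
  have "three_partition a b c"
  proof
    show "inf a b = bot" "inf b c = bot"
      unfolding b_def by (simp_all add: inf_assoc inf_commute inf_left_commute)
    show "inf a c = bot" by fact
    show "sup (sup a b) c = top"
      unfolding b_def using sup_compl_top[of "sup a c"] by (simp only: ac_simps)
    show "c \<noteq> bot" using ac(4) uf unfolding ultrafilter_def by auto
    show "a \<noteq> bot" using K(3) subalgebra_closed(1)[OF subalg] by auto
    show "b \<noteq> bot"
    proof
      assume "b = bot"
      then have "sup a c = top" unfolding b_def by (metis compl_bot_eq double_compl)
      then have "K = inf K (sup a c)" by simp
      then have "inf K a = K" using K(2) by (simp add: inf_sup_distrib1)
      then show False using K by simp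
    qed
  qed
  moreover have "b \<in> C" unfolding b_def using ac subalgebra_closed[OF C(1)] by auto
  ultimately show ?thesis
    using color_partition[of a b c] three_partition.three_atom_partition[of a b c]
      three_partition.partition_subset[OF _ C(1), of a b c] ac by fastforce
qed

end

theorem theorem1p1:
  assumes "countable_atomless (UNIV :: 'a::boolean_algebra set)"
  shows "\<exists>\<chi> :: 'a set \<Rightarrow> nat.
           infinite (\<chi> ` {D. three_atom_subalgebra D}) \<and>
           (\<forall>C. subalgebra C \<and> countable_atomless C \<longrightarrow>
              (\<forall>n \<in> \<chi> ` {D. three_atom_subalgebra D}.
                 \<exists>D. three_atom_subalgebra D \<and> D \<subseteq> C \<and> \<chi> D = n))"
proof -
  have nontriv: "(bot :: 'a) \<noteq> top" and cnt: "countable (UNIV :: 'a set)"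
    and atomless: "atoms (UNIV :: 'a set) = {}"
    using assms unfolding countable_atomless_def by auto
  define e where "e = from_nat_into (UNIV :: 'a set)"
  have e: "range e = UNIV" unfolding e_def using cnt by (simp add: range_from_nat_into)
  obtain u :: "'a set" where u: "ultrafilter u"
    using countable_ultrafilter_exists[OF nontriv e] by blast
  interpret filtration "level e" u
  proof
    show "level e m \<subseteq> level e n" if "m \<le> n" for m n
      using that by (rule lift_Suc_mono_le[of "level e", OF level_Suc_subset])
    show "\<exists>n. x \<in> level e n" for x
      using e level_contains by (metis UNIV_I rangeE)
  qed (fact subalgebra_level finite_level u)+
  \<comment> \<open>With the whole algebra as \<open>C\<close>, every natural number is seen to be a
    color, so the image is infinite.\<close>
  have "subalgebra (UNIV :: 'a set)" by (simp add: subalgebra_def)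
  then have "color ` {D. three_atom_subalgebra D} = UNIV"
    using color_attained[OF _ atomless] by (auto simp: image_iff) metis
  then show ?thesis
    using color_attained unfolding countable_atomless_def by (intro exI[of _ color]) auto
qed

end
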